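(* Let $c$ be a positive rational number, and let $A$ be an $\omega\times\omega$ matrix over $\mathbb Q$ whose rows are all possible rows (elements of $\mathbb Q^\omega$ with finitely many nonzero entries) whose entries have sum equal to $c$. Then $A$ is maximal IPR.
   Context: $\mathbb N=\{1,2,3,\ldots\}$, $\omega=\{0,1,2,\ldots\}$. All matrices have rational entries and only finitely many nonzero entries in each row. A matrix $A$ is image partition regular (IPR) if, whenever $\mathbb N$ is finitely coloured, there is a vector $\vec x$ with entries in $\mathbb N$ such that all entries of $A\vec x$ are natural numbers of the same colour. A matrix $A$ is maximal IPR provided it is IPR and, if $\vec r$ is a row (with rational entries) with finitely many nonzero entries which is not a row of $A$, then $\left(\begin{array}{c}\vec r\\ A\end{array}\right)$ is not IPR. *)

theory Defs
  imports Complex_Main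
begin

(* A matrix with rows indexed by 'i and columns indexed by 'j is a function
   'i => 'j => rat; an omega x omega matrix has type nat => nat => rat.
   Rows are functions 'j => rat. *)

definition finite_row :: "('j \<Rightarrow> rat) \<Rightarrow> bool" where
  "finite_row r \<longleftrightarrow> finite {j. r j \<noteq> 0}"

definition row_finite :: "('i \<Rightarrow> 'j \<Rightarrow> rat) \<Rightarrow> bool" where
  "row_finite M \<longleftrightarrow> (\<forall>i. finite_row (M i))"

definition row_sum :: "('j \<Rightarrow> rat) \<Rightarrow> rat" where
  "row_sum r = (\<Sum>j | r j \<noteq> 0. r j)"

definition mat_vec :: "('i \<Rightarrow> 'j \<Rightarrow> rat) \<Rightarrow> ('j \<Rightarrow> nat) \<Rightarrow> 'i \<Rightarrow> rat" where
  "mat_vec M x i = (\<Sum>j | M i j \<noteq> 0. M i j * of_nat (x j))"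

(* The positive integers {1,2,...} are {n::nat. n > 0}.  A finite colouring is a map
   chi taking finitely many values there; since only finitely many colours occur,
   taking them in nat is no restriction.  Only row-finite matrices are considered. *)

definition image_partition_regular :: "('i \<Rightarrow> 'j \<Rightarrow> rat) \<Rightarrow> bool" where
  "image_partition_regular M \<longleftrightarrow> row_finite M \<and>
     (\<forall>\<chi> :: nat \<Rightarrow> nat. finite (\<chi> ` {n. n > 0}) \<longrightarrow>
        (\<exists>x :: 'j \<Rightarrow> nat. (\<forall>j. x j > 0) \<and>
           (\<exists>k. \<forall>i. \<exists>n > 0. mat_vec M x i = of_nat n \<and> \<chi> n = k)))"

(* The new row is indexed by None, the row of M with index i by Some i. *)

definition add_row :: "('j \<Rightarrow> rat) \<Rightarrow> ('i \<Rightarrow> 'j \<Rightarrow> rat) \<Rightarrow> 'i option \<Rightarrow> 'j \<Rightarrow> rat" where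
  "add_row r M = case_option r M"

definition maximal_image_partition_regular :: "('i \<Rightarrow> 'j \<Rightarrow> rat) \<Rightarrow> bool" where
  "maximal_image_partition_regular M \<longleftrightarrow> image_partition_regular M \<and>
     (\<forall>r. finite_row r \<and> r \<notin> range M \<longrightarrow> \<not> image_partition_regular (add_row r M))"

end

theory Submission
  imports Defs
begin

text \<open>
  A constant vector \<open>d\<close> maps every row of sum \<open>c\<close> to the single value \<open>c * d\<close>, so \<open>A\<close> is image
  partition regular. Conversely the differences of rows of \<open>A\<close> are all rows of sum \<open>0\<close>, so \<open>A x\<close>
  can only have positive entries if \<open>x\<close> is constant. A new row of sum \<open>s \<noteq> c\<close> then forces \<open>c * d\<close>
  and \<open>s * d\<close> to have the same colour, which the parity of \<open>\<lfloor>log q n\<rfloor>\<close> with \<open>q = s / c\<close> prevents.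
\<close>

lemma row_sum_eq_sum:
  assumes "finite S" "{j. r j \<noteq> 0} \<subseteq> S"
  shows "row_sum r = sum r S"
  unfolding row_sum_def using assms by (intro sum.mono_neutral_left) auto

lemma mat_vec_eq_sum:
  assumes "finite S" "{j. M i j \<noteq> 0} \<subseteq> S"
  shows "mat_vec M x i = (\<Sum>j\<in>S. M i j * of_nat (x j))"
  unfolding mat_vec_def using assms by (intro sum.mono_neutral_left) auto

lemma mat_vec_const: "mat_vec M (\<lambda>_. d) i = row_sum (M i) * of_nat d"
  by (simp add: mat_vec_def row_sum_def sum_distrib_right)

lemma mat_vec_add_row_Some [simp]: "mat_vec (add_row r M) x (Some i) = mat_vec M x i"
  by (simp add: mat_vec_def add_row_def)

text \<open>Taking the denominator of \<open>c\<close> as the constant entry of the vector makes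
  every entry of the image equal to the numerator of \<open>c\<close>, a single positive
  integer.\<close>

lemma image_partition_regular_if_const_row_sum:
  assumes "c > 0" "row_finite M" "\<And>i. row_sum (M i) = c"
  shows "image_partition_regular M"
proof -
  obtain a b where ab: "quotient_of c = (a, b)"
    by fastforce
  have b: "b > 0"
    using quotient_of_denom_pos[OF ab] .
  have c: "c = of_int a / of_int b"
    using quotient_of_div[OF ab] .
  have a: "a > 0"
    using \<open>c > 0\<close> b by (simp add: c zero_less_divide_iff)
  have "mat_vec M (\<lambda>_. nat b) i = of_nat (nat a)" for i
    using a b by (simp add: mat_vec_const assms(3) c)
  moreover have "nat a > 0" "nat b > 0"
    using a b by simp_all
  ultimately show ?thesis
    unfolding image_partition_regular_def using \<open>row_finite M\<close> by metis
qed

text \<open>If \<open>x\<close> took different values at two columns, shifting weight between them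
  would keep the row sum at \<open>c\<close> while driving the entry to any rational, in particular
  a negative one.\<close>

lemma const_if_mat_vec_nonneg:
  fixes M :: "'i \<Rightarrow> 'j \<Rightarrow> rat" and x :: "'j \<Rightarrow> nat"
  assumes rows: "{r. finite_row r \<and> row_sum r = c} \<subseteq> range M"
    and nonneg: "\<And>i. mat_vec M x i \<ge> 0"
  shows "x j = x k"
proof (rule ccontr)
  assume ne: "x j \<noteq> x k"
  then have jk: "j \<noteq> k" by auto
  \<comment> \<open>Solution of \<open>c * x j + t * (x j - x k) = -1\<close>, whose left side is
    the entry produced by the row \<open>r\<close>.\<close>
  define t :: rat where "t = - (1 + c * of_nat (x j)) / (of_nat (x j) - of_nat (x k))"
  define r :: "'j \<Rightarrow> rat" where "r = (\<lambda>_. 0)(j := c + t, k := - t)"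
  have supp: "{l. r l \<noteq> 0} \<subseteq> {j, k}"
    by (auto simp: r_def split: if_splits)
  then have "finite_row r"
    unfolding finite_row_def by (rule finite_subset) simp
  moreover have "row_sum r = c"
    by (subst row_sum_eq_sum[OF _ supp]) (use jk in \<open>simp_all add: r_def\<close>)
  ultimately obtain i where i: "M i = r"
    using rows by blast
  have "mat_vec M x i = (c + t) * of_nat (x j) - t * of_nat (x k)"
    using mat_vec_eq_sum[of "{j, k}" M i x] supp jk by (simp add: i) (simp add: r_def)
  also have "\<dots> = c * of_nat (x j) + t * (of_nat (x j) - of_nat (x k))"
    by (simp add: algebra_simps)
  also have "\<dots> = -1"
    using ne by (simp add: t_def)
  finally show False
    using nonneg[of i] by simp
qed

text \<open>Multiplication by \<open>q\<close> raises \<open>log q\<close> by exactly 1, also for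
  \<open>q < 1\<close>, so the parity of its floor flips.\<close>

lemma ex_colouring_separating_ratio:
  fixes q :: real
  assumes "q > 0" "q \<noteq> 1"
  obtains \<chi> :: "nat \<Rightarrow> nat" where "finite (range \<chi>)"
    and "\<And>m n. n > 0 \<Longrightarrow> real m = q * real n \<Longrightarrow> \<chi> m \<noteq> \<chi> n"
proof
  define \<chi> where "\<chi> n = nat (\<lfloor>log q (real n)\<rfloor> mod 2)" for n
  have "range \<chi> \<subseteq> {..<2}"
    by (auto simp: \<chi>_def nat_less_iff)
  then show "finite (range \<chi>)"
    by (rule finite_subset) simp
  show "\<chi> m \<noteq> \<chi> n" if "n > 0" "real m = q * real n" for m n
  proof -
    have "log q (real m) = log q (real n) + 1"
      using assms that by (simp add: log_mult)
    then have "\<lfloor>log q (real m)\<rfloor> = \<lfloor>log q (real n)\<rfloor> + 1"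
      by simp
    then show ?thesis
      \<comment> \<open>The floors may be negative, but their residues mod 2 are 0 or 1, so
        \<open>nat\<close> identifies nothing.\<close>
      unfolding \<chi>_def by (simp add: nat_eq_iff) presburger
  qed
qed

theorem proposition3p2:
  fixes c :: rat and A :: "nat \<Rightarrow> nat \<Rightarrow> rat"
  assumes "c > 0"
    and "range A = {r. finite_row r \<and> row_sum r = c}"
  shows "maximal_image_partition_regular A"
  unfolding maximal_image_partition_regular_def
proof (intro conjI allI impI)
  have A: "finite_row (A i)" "row_sum (A i) = c" for i
    using assms(2) by blast+
  then show "image_partition_regular A"
    using \<open>c > 0\<close> by (intro image_partition_regular_if_const_row_sum) (auto simp: row_finite_def)
  fix r assume r: "finite_row r \<and> r \<notin> range A"
  define s where "s = row_sum r"
  have "s \<noteq> c"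
    using r assms(2) by (auto simp: s_def)
  show "\<not> image_partition_regular (add_row r A)"
  proof
    assume ipr: "image_partition_regular (add_row r A)"
    \<comment> \<open>Stated for every colouring because it is used twice: for the sign of
      \<open>s\<close> and for the contradiction.\<close>
    have mono: "\<exists>d m n. m > 0 \<and> n > 0 \<and> s * of_nat d = of_nat m \<and> c * of_nat d = of_nat n \<and> \<chi> m = \<chi> n"
      if \<chi>: "finite (range \<chi>)" for \<chi> :: "nat \<Rightarrow> nat"
    proof -
      have "finite (\<chi> ` {n. n > 0})"
        using \<chi> by (rule finite_subset[rotated]) auto
      then obtain x k where x: "\<And>i. \<exists>n>0. mat_vec (add_row r A) x i = of_nat n \<and> \<chi> n = k"
        using ipr unfolding image_partition_regular_def by meson
      have "mat_vec A x i \<ge> 0" for i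
        using x[of "Some i"] by auto
      then have "x j = x 0" for j
        using assms(2) by (intro const_if_mat_vec_nonneg[of c A]) auto
      then have "x = (\<lambda>_. x 0)" ..
      then obtain d where xd: "x = (\<lambda>_. d)" by blast
      have "mat_vec (add_row r A) x None = s * of_nat d"
        unfolding xd mat_vec_const by (simp add: add_row_def s_def)
      \<comment> \<open>Any row of \<open>A\<close> would do, as all give
        \<open>c * d\<close>.\<close>
      moreover have "mat_vec (add_row r A) x (Some 0) = c * of_nat d"
        by (simp add: xd) (simp add: mat_vec_const A)
      ultimately show ?thesis
        using x[of None] x[of "Some 0"] by metis
    qed
    have "s > 0"
    proof -
      obtain d m where "m > 0" "s * of_nat d = of_nat (m :: nat)"
        \<comment> \<open>One colour suffices here: only the positivity of the new entry
          matters.\<close>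
        using mono[of "\<lambda>_. 0"] by auto
      then have "s * of_nat d > 0" by simp
      then show ?thesis
        by (auto simp: zero_less_mult_iff)
    qed
    define q where "q = real_of_rat (s / c)"
    have "q > 0" "q \<noteq> 1"
      using \<open>s > 0\<close> \<open>c > 0\<close> \<open>s \<noteq> c\<close> by (simp_all add: q_def)
    then obtain \<chi> :: "nat \<Rightarrow> nat" where \<chi>: "finite (range \<chi>)"
      "\<And>m n. n > 0 \<Longrightarrow> real m = q * real n \<Longrightarrow> \<chi> m \<noteq> \<chi> n"
      using ex_colouring_separating_ratio by blast
    obtain d m n where dmn: "m > 0" "n > 0" "s * of_nat d = of_nat m" "c * of_nat d = of_nat n"
      "\<chi> m = \<chi> n"
      using mono[OF \<chi>(1)] by blast
    have "of_nat m = s / c * of_nat n"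
      using \<open>c > 0\<close> by (simp flip: dmn(3,4))
    then have "real_of_rat (of_nat m) = real_of_rat (s / c * of_nat n)"
      by simp
    then have "real m = q * real n"
      unfolding q_def of_rat_mult by simp
    with \<chi>(2) dmn show False by blast
  qed
qed

end
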